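(* Let $\ell,m\ge 1$ be integers and let $(w_{jk})_{1\le j\le \ell,\,1\le k\le m}$ be nonnegative integers such that every row sum $\sum_{k} w_{jk}$ and every column sum $\sum_j w_{jk}$ is strictly positive; let $n:=\sum_{j,k} w_{jk}$. With the index set $\mathcal{P}$, the closed convex cone $\Theta\subset\mathbb{R}^{\mathcal{P}}$ and the function $f:\mathbb{R}^{\mathcal{P}}\to\mathbb{R}$ defined in the context, there exists a unique minimizer $\hat{\boldsymbol\theta}$ of $f(\boldsymbol\theta)$ over all $\boldsymbol\theta\in\Theta$.
   Context: The $w_{jk}$ are the counts $w_{jk}=\#\{i:(X_i,Y_i)=(x_j,y_k)\}$ of $n$ observations $(X_i,Y_i)$, where $x_1<\dots<x_\ell$ and $y_1<\dots<y_m$ are the distinct observed values of the $X_i$ and of the $Y_i$ (so all row and column sums of $(w_{jk})$ are positive). $\mathcal{P}$ is the set of all index pairs $(j,k)\in\{1,\dots,\ell\}\times\{1,\dots,m\}$ such that there exist indices $1\le j_1\le j\le j_2\le \ell$ and $1\le k_1\le k\le k_2\le m$ with $w_{j_1k_2}>0$ and $w_{j_2k_1}>0$. (If $(j-1,k),(j,k-1)\in\mathcal{P}$, then also $(j-1,k-1),(j,k)\in\mathcal{P}$.) $\Theta$ is the set of all $\boldsymbol\theta=(\theta_{jk})_{(j,k)\in\mathcal{P}}\in\mathbb{R}^{\mathcal{P}}$ such that $$\theta_{j-1,k-1}+\theta_{j,k}-\theta_{j-1,k}-\theta_{j,k-1}\ge 0$$ for all $1<j\le\ell$, $1<k\le m$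 with $(j-1,k),(j,k-1)\in\mathcal{P}$. $f(\boldsymbol\theta):=\sum_{(j,k)\in\mathcal{P}}\bigl(-w_{jk}\theta_{jk}+n\exp(\theta_{jk})\bigr)$. *)

theory Defs
  imports "HOL-Analysis.Analysis"
begin

text \<open>
  Weights are functions \<open>w j k\<close>; only the values at \<open>j \<in> {1..l}\<close>, \<open>k \<in> {1..m}\<close> matter.
\<close>

definition total_weight :: "nat \<Rightarrow> nat \<Rightarrow> (nat \<Rightarrow> nat \<Rightarrow> nat) \<Rightarrow> nat" where
  "total_weight l m w = (\<Sum>j\<in>{1..l}. \<Sum>k\<in>{1..m}. w j k)"

definition index_pairs :: "nat \<Rightarrow> nat \<Rightarrow> (nat \<Rightarrow> nat \<Rightarrow> nat) \<Rightarrow> (nat \<times> nat) set" where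
  "index_pairs l m w = {(j, k). j \<in> {1..l} \<and> k \<in> {1..m} \<and>
     (\<exists>j1 j2 k1 k2. 1 \<le> j1 \<and> j1 \<le> j \<and> j \<le> j2 \<and> j2 \<le> l \<and>
                    1 \<le> k1 \<and> k1 \<le> k \<and> k \<le> k2 \<and> k2 \<le> m \<and>
                    w j1 k2 > 0 \<and> w j2 k1 > 0)}"

text \<open>
  The other two corners of a \<open>2 \<times> 2\<close> block then also lie in the index set, so the
  inequality in \<open>param_cone\<close> below involves only coordinates in the index set.
\<close>

lemma index_pairs_corners:
  assumes "1 < j" "1 < k"
    and "(j - 1, k) \<in> index_pairs l m w" "(j, k - 1) \<in> index_pairs l m w"
  shows "(j - 1, k - 1) \<in> index_pairs l m w" "(j, k) \<in> index_pairs l m w"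
proof -
  from assms(3) obtain a d where a: "1 \<le> a" "a \<le> j - 1" "k \<le> d" "d \<le> m" "w a d > 0"
    unfolding index_pairs_def by blast
  from assms(4) obtain b c where b: "j \<le> b" "b \<le> l" "1 \<le> c" "c \<le> k - 1" "w b c > 0"
    unfolding index_pairs_def by blast
  have 1: "j - 1 \<in> {1..l}" "k - 1 \<in> {1..m}" "j \<in> {1..l}" "k \<in> {1..m}"
    using assms(1,2) a b by auto
  have 2: "a \<le> j" "j - 1 \<le> b" "c \<le> k" "k - 1 \<le> d" using a b by auto
  show "(j - 1, k - 1) \<in> index_pairs l m w" "(j, k) \<in> index_pairs l m w"
    unfolding index_pairs_def using 1 2 a b by blast+
qed

text \<open>
  The space of real vectors indexed by a set \<open>P\<close> is represented by \<open>P \<rightarrow>\<^sub>E UNIV\<close>: functions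
  with the fixed value \<open>undefined\<close> outside \<open>P\<close>, so that equality of such functions is
  equality of the coordinates in \<open>P\<close>.
\<close>

definition param_cone :: "nat \<Rightarrow> nat \<Rightarrow> (nat \<Rightarrow> nat \<Rightarrow> nat) \<Rightarrow> (nat \<times> nat \<Rightarrow> real) set" where
  "param_cone l m w = {\<theta> \<in> index_pairs l m w \<rightarrow>\<^sub>E UNIV.
     \<forall>j k. 1 < j \<and> j \<le> l \<and> 1 < k \<and> k \<le> m \<and>
           (j - 1, k) \<in> index_pairs l m w \<and> (j, k - 1) \<in> index_pairs l m w \<longrightarrow>
           \<theta> (j - 1, k - 1) + \<theta> (j, k) - \<theta> (j - 1, k) - \<theta> (j, k - 1) \<ge> 0}"

definition objective ::
  "nat \<Rightarrow> nat \<Rightarrow> (nat \<Rightarrow> nat \<Rightarrow> nat) \<Rightarrow> (nat \<times> nat \<Rightarrow> real) \<Rightarrow> real" where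
  "objective l m w \<theta> = (\<Sum>(j, k)\<in>index_pairs l m w.
     - real (w j k) * \<theta> (j, k) + real (total_weight l m w) * exp (\<theta> (j, k)))"

end

theory Submission
  imports Defs
begin

text \<open>
  The objective is strictly convex, so only existence is an issue, and by compactness it suffices
  that the sublevel sets of the objective on the cone are bounded. Every summand is nonnegative, so
  a bound on the objective gives an upper bound for all coordinates and a lower bound for those
  with positive weight. By telescoping, the inequalities defining the cone hold for all rectangles
  in the index set, and they propagate these lower bounds: for an index pair \<open>(j, k)\<close>, observations
  in row \<open>j\<close> and column \<open>k\<close>, together with the ones witnessing membership in the index set, bound
  the coordinate \<open>(j, k)\<close> from below.
\<close>

section \<open>Combinatorics of the index set and weights\<close>

lemma finite_index_pairs: "finite (index_pairs l m w)"
proof (rule finite_subset)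
  show "index_pairs l m w \<subseteq> {1..l} \<times> {1..m}"
    unfolding index_pairs_def by auto
qed simp

lemma positive_weight_in_index_pairs:
  assumes "j \<in> {1..l}" "k \<in> {1..m}" "w j k > 0"
  shows "(j, k) \<in> index_pairs l m w"
proof -
  have "1 \<le> j" "j \<le> l" "1 \<le> k" "k \<le> m" using assms by auto
  then show ?thesis
    unfolding index_pairs_def using assms by blast
qed

lemma weight_le_total_weight:
  assumes "j \<in> {1..l}" "k \<in> {1..m}"
  shows "w j k \<le> total_weight l m w"
proof -
  have "w j k \<le> (\<Sum>k\<in>{1..m}. w j k)"
    using assms(2) by (intro member_le_sum) auto
  also have "\<dots> \<le> total_weight l m w"
    unfolding total_weight_def
    using assms(1) by (intro member_le_sum[of j _ "\<lambda>j. \<Sum>k\<in>{1..m}. w j k"]) auto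
  finally show ?thesis .
qed

text \<open>The observation with small row and large column behind \<open>(a, d)\<close> and the one
  with large row and small column behind \<open>(b, c)\<close> together witness
  \<open>(j, k)\<close>. So a rectangle is in the index set once these two opposite corners
  are.\<close>

lemma rectangle_subset_index_pairs:
  assumes "(a, d) \<in> index_pairs l m w" "(b, c) \<in> index_pairs l m w"
    and "a \<le> j" "j \<le> b" "c \<le> k" "k \<le> d"
  shows "(j, k) \<in> index_pairs l m w"
proof -
  from assms(1) obtain a' d' where "1 \<le> a'" "a' \<le> a" "d \<le> d'" "d' \<le> m" "w a' d' > 0"
    unfolding index_pairs_def by blast
  moreover from assms(2) obtain b' c' where "b \<le> b'" "b' \<le> l" "1 \<le> c'" "c' \<le> c" "w b' c' > 0"
    unfolding index_pairs_def by blast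
  ultimately have "1 \<le> a'" "a' \<le> j" "j \<le> b'" "b' \<le> l" "1 \<le> c'" "c' \<le> k" "k \<le> d'" "d' \<le> m"
    "w a' d' > 0" "w b' c' > 0" "j \<in> {1..l}" "k \<in> {1..m}"
    using assms(3-6) by auto
  then show ?thesis
    unfolding index_pairs_def by blast
qed

section \<open>Rectangle inequalities and lower bounds on the cone\<close>

lemma param_cone_rectangle:
  assumes \<theta>: "\<theta> \<in> param_cone l m w"
    and ad: "(a, d) \<in> index_pairs l m w" and bc: "(b, c) \<in> index_pairs l m w"
    and "a \<le> b" "c \<le> d"
  shows "\<theta> (a, d) + \<theta> (b, c) \<le> \<theta> (a, c) + \<theta> (b, d)"
proof -
  \<comment> \<open>The claim says \<open>D a \<le> D b\<close>. Telescoping over rows, and over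
    columns inside each \<open>D i\<close>, splits \<open>D b - D a\<close> into unit-square terms,
    each nonnegative by a cone constraint.\<close>
  define D where "D i = \<theta> (i, d) - \<theta> (i, c)" for i
  have bounds: "1 \<le> a" "b \<le> l" "1 \<le> c" "d \<le> m"
    using ad bc unfolding index_pairs_def by auto
  have D_eq: "D i = (\<Sum>k\<in>{c..<d}. \<theta> (i, Suc k) - \<theta> (i, k))" for i
    unfolding D_def using sum_Suc_diff'[OF \<open>c \<le> d\<close>, of "\<lambda>k. \<theta> (i, k)"] by simp
  have "0 \<le> D (Suc i) - D i" if i: "i \<in> {a..<b}" for i
    unfolding D_eq sum_subtractf[symmetric]
  proof (rule sum_nonneg)
    fix k assume k: "k \<in> {c..<d}"
    have "(i, Suc k) \<in> index_pairs l m w" "(Suc i, k) \<in> index_pairs l m w"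
      using i k by (auto intro!: rectangle_subset_index_pairs[OF ad bc])
    moreover have "1 < Suc i" "Suc i \<le> l" "1 < Suc k" "Suc k \<le> m"
      using bounds i k by auto
    ultimately have "0 \<le> \<theta> (Suc i - 1, Suc k - 1) + \<theta> (Suc i, Suc k)
        - \<theta> (Suc i - 1, Suc k) - \<theta> (Suc i, Suc k - 1)"
      using \<theta> unfolding param_cone_def by (metis (mono_tags, lifting) diff_Suc_1 mem_Collect_eq)
    then show "0 \<le> \<theta> (Suc i, Suc k) - \<theta> (Suc i, k) - (\<theta> (i, Suc k) - \<theta> (i, k))"
      by simp
  qed
  then have "0 \<le> (\<Sum>i\<in>{a..<b}. D (Suc i) - D i)"
    by (rule sum_nonneg)
  also have "\<dots> = D b - D a"
    by (rule sum_Suc_diff'[OF \<open>a \<le> b\<close>])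
  finally show ?thesis
    unfolding D_def by simp
qed

text \<open>The rectangle inequality turns lower bounds \<open>- A\<close> and \<open>- B\<close> at
  two opposite corners into \<open>- A - B - C\<close> at a third, the fourth being at most
  \<open>C\<close>. One application to observations gives \<open>- 3 * C\<close>; a second, with one
  further observation, gives \<open>- 5 * C\<close>.\<close>

lemma param_cone_lower_bound:
  assumes rows: "\<And>j. j \<in> {1..l} \<Longrightarrow> (\<Sum>k\<in>{1..m}. w j k) > 0"
    and cols: "\<And>k. k \<in> {1..m} \<Longrightarrow> (\<Sum>j\<in>{1..l}. w j k) > 0"
    and \<theta>: "\<theta> \<in> param_cone l m w"
    and upper: "\<And>p. p \<in> index_pairs l m w \<Longrightarrow> \<theta> p \<le> C"
    and lower: "\<And>j k. (j, k) \<in> index_pairs l m w \<Longrightarrow> w j k > 0 \<Longrightarrow> - C \<le> \<theta> (j, k)"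
    and "0 \<le> C"
    and p: "(j, k) \<in> index_pairs l m w"
  shows "- 5 * C \<le> \<theta> (j, k)"
proof -
  define P where "P = index_pairs l m w"
  have upper_left: "\<theta> (a, d) + \<theta> (b, c) - C \<le> \<theta> (a, c)" "(a, c) \<in> P"
    and lower_right: "\<theta> (a, d) + \<theta> (b, c) - C \<le> \<theta> (b, d)" "(b, d) \<in> P"
    if "(a, d) \<in> P" "(b, c) \<in> P" "a \<le> b" "c \<le> d" for a b c d
  proof -
    show *: "(a, c) \<in> P" "(b, d) \<in> P"
      using that unfolding P_def by (auto intro: rectangle_subset_index_pairs[of a d _ _ _ b c])
    show "\<theta> (a, d) + \<theta> (b, c) - C \<le> \<theta> (a, c)" "\<theta> (a, d) + \<theta> (b, c) - C \<le> \<theta> (b, d)"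
      using param_cone_rectangle[OF \<theta>, of a d b c] upper[of "(a, c)"] upper[of "(b, d)"] that *
      unfolding P_def by auto
  qed
  from p obtain j1 j2 k1 k2 where jk: "j \<in> {1..l}" "k \<in> {1..m}"
    "1 \<le> j1" "j1 \<le> j" "j \<le> j2" "j2 \<le> l" "1 \<le> k1" "k1 \<le> k" "k \<le> k2" "k2 \<le> m"
    "w j1 k2 > 0" "w j2 k1 > 0"
    unfolding index_pairs_def by blast
  obtain k' where k': "k' \<in> {1..m}" "w j k' > 0"
    using rows[OF jk(1)] by (metis gr0I less_irrefl sum.neutral)
  obtain j' where j': "j' \<in> {1..l}" "w j' k > 0"
    using cols[OF jk(2)] by (metis gr0I less_irrefl sum.neutral)
  have obs: "(j1, k2) \<in> P" "(j2, k1) \<in> P" "(j, k') \<in> P" "(j', k) \<in> P"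
    using jk k' j' unfolding P_def by (auto intro!: positive_weight_in_index_pairs)
  then have obs_lower: "- C \<le> \<theta> (j1, k2)" "- C \<le> \<theta> (j2, k1)" "- C \<le> \<theta> (j, k')" "- C \<le> \<theta> (j', k)"
    using lower jk k' j' unfolding P_def by auto
  \<comment> \<open>The observations \<open>(j, k')\<close> and \<open>(j', k)\<close> span a
    rectangle with corner \<open>(j, k)\<close>. In the first two cases the rectangle inequality
    bounds that corner at once. In the other two \<open>(j, k)\<close> is on the wrong diagonal, and
    one observation must first be replaced.\<close>
  consider "k' \<le> k" "j' \<le> j" | "k \<le> k'" "j \<le> j'" | "k' \<le> k" "j \<le> j'" | "k \<le> k'" "j' \<le> j"
    by linarith
  then show ?thesis
  proof cases
    case 1
    then show ?thesis using lower_right(1)[of j' k j k'] obs obs_lower \<open>0 \<le> C\<close> by simp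
  next
    case 2
    then show ?thesis using upper_left(1)[of j k' j' k] obs obs_lower \<open>0 \<le> C\<close> by simp
  next
    case 3
    \<comment> \<open>Replace \<open>(j, k')\<close>, which lies to the left of column
      \<open>k\<close>, by \<open>(j, k2)\<close> to its right.\<close>
    then have "- 3 * C \<le> \<theta> (j, k2)" "(j, k2) \<in> P"
      using lower_right[of j1 k2 j k'] obs obs_lower jk by auto
    then show ?thesis using upper_left(1)[of j k2 j' k] obs obs_lower jk 3 by simp
  next
    case 4
    \<comment> \<open>Replace \<open>(j', k)\<close>, which lies above row \<open>j\<close>, by
      \<open>(j2, k)\<close> below it.\<close>
    then have "- 3 * C \<le> \<theta> (j2, k)" "(j2, k) \<in> P"
      using lower_right[of j' k j2 k1] obs obs_lower jk by auto
    then show ?thesis using upper_left(1)[of j k' j2 k] obs obs_lower jk 4 by simp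
  qed
qed

section \<open>One-variable estimates for a linear term plus an exponential\<close>

lemma linear_exp_nonneg:
  fixes a b x :: real
  assumes "0 \<le> a" "a \<le> b"
  shows "0 \<le> - a * x + b * exp x"
proof (cases "0 \<le> x")
  case True
  have "a * x \<le> b * x" using assms True by (simp add: mult_right_mono)
  also have "\<dots> \<le> b * exp x"
    using assms exp_ge_add_one_self[of x] by (intro mult_left_mono) linarith+
  finally show ?thesis by simp
next
  case False
  then have "a * x \<le> 0" using assms by (simp add: mult_nonneg_nonpos)
  moreover have "0 \<le> b * exp x" using assms by simp
  ultimately show ?thesis by linarith
qed

lemma linear_exp_upper_bound:
  fixes a b x :: real
  assumes "0 \<le> a" "a \<le> b" "1 \<le> b" "- a * x + b * exp x \<le> C" "0 \<le> C"
  shows "x \<le> C"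
proof (cases "0 \<le> x")
  case True
  \<comment> \<open>This yields \<open>2 * x \<le> exp x\<close>, so that \<open>exp x - x\<close>
    still dominates \<open>x\<close> after the linear term has been absorbed using
    \<open>a \<le> b\<close>.\<close>
  have "0 \<le> (x - 1)\<^sup>2" by simp
  then have "2 * x \<le> 1 + x + x\<^sup>2 / 2"
    by (simp add: power2_eq_square algebra_simps)
  also have "\<dots> \<le> exp x"
    using exp_lower_Taylor_quadratic[OF True] .
  finally have x: "x \<le> exp x - x" by simp
  also have "\<dots> \<le> b * (exp x - x)"
    using mult_right_mono[OF \<open>1 \<le> b\<close>, of "exp x - x"] True x by simp
  also have "\<dots> \<le> - a * x + b * exp x"
    using assms True by (simp add: algebra_simps mult_right_mono)
  finally show ?thesis using assms by simp
qed (use assms in simp)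

lemma linear_exp_lower_bound:
  fixes a b x :: real
  assumes "1 \<le> a" "0 \<le> b" "- a * x + b * exp x \<le> C" "0 \<le> C"
  shows "- C \<le> x"
proof (cases "0 \<le> x")
  case False
  then have "- x \<le> - a * x" using assms by simp
  also have "\<dots> \<le> - a * x + b * exp x" using assms by simp
  finally show ?thesis using assms by simp
qed (use assms in simp)

text \<open>Strict AM-GM inequality for \<open>exp x\<close> and \<open>exp y\<close>, obtained from
  the square of the difference of their roots.\<close>

lemma exp_midpoint_less:
  fixes x y :: real
  assumes "x \<noteq> y"
  shows "exp ((x + y) / 2) < (exp x + exp y) / 2"
proof -
  have "0 < (exp (x / 2) - exp (y / 2))\<^sup>2"
    using assms by simp
  also have "\<dots> = exp x + exp y - 2 * exp ((x + y) / 2)"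
    by (simp add: power2_diff add_divide_distrib exp_add flip: exp_double)
  finally show ?thesis by simp
qed

section \<open>Boundedness of sublevel sets\<close>

lemma objective_sublevel_bounded:
  assumes rows: "\<And>j. j \<in> {1..l} \<Longrightarrow> (\<Sum>k\<in>{1..m}. w j k) > 0"
    and cols: "\<And>k. k \<in> {1..m} \<Longrightarrow> (\<Sum>j\<in>{1..l}. w j k) > 0"
    and \<theta>: "\<theta> \<in> param_cone l m w"
    and "total_weight l m w > 0"
    and C: "objective l m w \<theta> \<le> C" "0 \<le> C"
    and p: "p \<in> index_pairs l m w"
  shows "\<theta> p \<in> {- 5 * C..5 * C}"
proof -
  define n where "n = real (total_weight l m w)"
  have n: "1 \<le> n" using assms(4) unfolding n_def by simp
  have w_le: "real (w j k) \<le> n" if "(j, k) \<in> index_pairs l m w" for j k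
    using that weight_le_total_weight[of j l k m w] unfolding index_pairs_def n_def by simp
  have summand: "- real (w j k) * \<theta> (j, k) + n * exp (\<theta> (j, k)) \<le> C"
    if "(j, k) \<in> index_pairs l m w" for j k
  proof -
    let ?g = "\<lambda>(j, k). - real (w j k) * \<theta> (j, k) + n * exp (\<theta> (j, k))"
    have "0 \<le> ?g q" if "q \<in> index_pairs l m w" for q
      using linear_exp_nonneg[OF _ w_le] that by (cases q) auto
    then have "?g (j, k) \<le> sum ?g (index_pairs l m w)"
      using that finite_index_pairs by (intro member_le_sum) auto
    also have "\<dots> \<le> C"
      using C(1) unfolding objective_def n_def .
    finally show ?thesis by simp
  qed
  have upper: "\<theta> q \<le> C" if "q \<in> index_pairs l m w" for q
    using linear_exp_upper_bound[OF _ w_le n summand C(2)] that by (cases q) auto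
  \<comment> \<open>A positive weight is an integer, hence at least 1 as the one-variable bound
    requires.\<close>
  have lower: "- C \<le> \<theta> (j, k)" if "(j, k) \<in> index_pairs l m w" "w j k > 0" for j k
    using linear_exp_lower_bound[OF _ _ summand C(2)] that n by auto
  have "- 5 * C \<le> \<theta> p"
    using param_cone_lower_bound[OF rows cols \<theta> upper lower C(2)] p by (cases p) auto
  then show ?thesis
    using upper[OF p] C(2) by simp
qed

section \<open>Compactness and continuity\<close>

lemma compact_PiE:
  fixes K :: "'a \<Rightarrow> 'b::topological_space set"
  assumes "\<And>i. i \<in> I \<Longrightarrow> compact (K i)"
  shows "compact (PiE I K)"
proof -
  \<comment> \<open>Being extensional means having the compact factor \<open>{undefined}\<close> at
    every index outside \<open>I\<close>, so Tychonoff's theorem applies to the product over all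
    indices.\<close>
  have "PiE I K = PiE UNIV (\<lambda>i. if i \<in> I then K i else {undefined})"
    by (auto simp: PiE_def Pi_def extensional_def split: if_splits)
  moreover have "compactin (product_topology (\<lambda>_. euclidean) UNIV)
      (PiE UNIV (\<lambda>i. if i \<in> I then K i else {undefined}))"
    using assms by (simp add: compactin_PiE)
  ultimately show ?thesis
    by (simp add: euclidean_product_topology)
qed

lemma compact_param_cone_box:
  "compact (param_cone l m w \<inter> (index_pairs l m w \<rightarrow>\<^sub>E {a..b}))"
proof -
  \<comment> \<open>Only the inequalities are kept here, giving a closed set in the full function
    space; extensionality is supplied by the box.\<close>
  let ?S = "{\<theta> :: nat \<times> nat \<Rightarrow> real. \<forall>j k. 1 < j \<and> j \<le> l \<and> 1 < k \<and> k \<le> m \<and>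
           (j - 1, k) \<in> index_pairs l m w \<and> (j, k - 1) \<in> index_pairs l m w \<longrightarrow>
           0 \<le> \<theta> (j - 1, k - 1) + \<theta> (j, k) - \<theta> (j - 1, k) - \<theta> (j, k - 1)}"
  have "closed ?S"
    by (intro closed_Collect_all closed_Collect_imp open_Collect_const closed_Collect_le
        continuous_intros continuous_on_product_coordinates)
  then have "compact ((index_pairs l m w \<rightarrow>\<^sub>E {a..b}) \<inter> ?S)"
    by (intro compact_Int_closed compact_PiE) auto
  moreover have "param_cone l m w \<inter> (index_pairs l m w \<rightarrow>\<^sub>E {a..b})
      = (index_pairs l m w \<rightarrow>\<^sub>E {a..b}) \<inter> ?S"
    unfolding param_cone_def by auto
  ultimately show ?thesis by simp
qed

lemma continuous_on_objective: "continuous_on S (objective l m w)"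
  unfolding objective_def case_prod_unfold
  by (intro continuous_intros continuous_on_subset[OF continuous_on_product_coordinates]) auto

section \<open>Zero and midpoints in the cone, strict convexity of the objective\<close>

lemma zero_in_param_cone: "(\<lambda>p\<in>index_pairs l m w. 0) \<in> param_cone l m w"
  \<comment> \<open>The restricted function is 0 only on the index set, so all four corners of each
    constraint must be known to lie there.\<close>
  unfolding param_cone_def using index_pairs_corners[of _ _ l m w] by auto

lemma midpoint_in_param_cone:
  assumes "\<theta> \<in> param_cone l m w" "\<eta> \<in> param_cone l m w"
  shows "(\<lambda>p\<in>index_pairs l m w. (\<theta> p + \<eta> p) / 2) \<in> param_cone l m w"
proof -
  let ?\<mu> = "\<lambda>p\<in>index_pairs l m w. (\<theta> p + \<eta> p) / 2"
  have "0 \<le> ?\<mu> (j - 1, k - 1) + ?\<mu> (j, k) - ?\<mu> (j - 1, k) - ?\<mu> (j, k - 1)"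
    if *: "1 < j" "j \<le> l" "1 < k" "k \<le> m"
      "(j - 1, k) \<in> index_pairs l m w" "(j, k - 1) \<in> index_pairs l m w" for j k
  proof -
    have "0 \<le> \<theta> (j - 1, k - 1) + \<theta> (j, k) - \<theta> (j - 1, k) - \<theta> (j, k - 1)"
      "0 \<le> \<eta> (j - 1, k - 1) + \<eta> (j, k) - \<eta> (j - 1, k) - \<eta> (j, k - 1)"
      using assms * unfolding param_cone_def by auto
    then show ?thesis
      using * index_pairs_corners[OF *(1,3,5,6)] by (simp add: field_simps)
  qed
  then show ?thesis
    unfolding param_cone_def by auto
qed

lemma objective_midpoint_less:
  assumes "\<theta> \<in> param_cone l m w" "\<eta> \<in> param_cone l m w" "\<theta> \<noteq> \<eta>"
    and "total_weight l m w > 0"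
  shows "objective l m w (\<lambda>p\<in>index_pairs l m w. (\<theta> p + \<eta> p) / 2)
    < (objective l m w \<theta> + objective l m w \<eta>) / 2"
proof -
  define n where "n = real (total_weight l m w)"
  have n: "0 < n" using assms(4) unfolding n_def by simp
  let ?P = "index_pairs l m w"
  let ?h = "\<lambda>\<theta> p. - real (w (fst p) (snd p)) * \<theta> p + n * exp (\<theta> p)"
  have obj: "objective l m w \<theta> = (\<Sum>p\<in>?P. ?h \<theta> p)" for \<theta>
    unfolding objective_def n_def case_prod_unfold by simp
  let ?\<mu> = "\<lambda>p\<in>?P. (\<theta> p + \<eta> p) / 2"
  have less: "?h ?\<mu> p < (?h \<theta> p + ?h \<eta> p) / 2" if "p \<in> ?P" "\<theta> p \<noteq> \<eta> p" for p
    using mult_strict_left_mono[OF exp_midpoint_less[OF that(2)] n] that(1)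
    by (simp add: field_simps)
  have "?h ?\<mu> p \<le> (?h \<theta> p + ?h \<eta> p) / 2" if "p \<in> ?P" for p
    using less[OF that] that by (cases "\<theta> p = \<eta> p") auto
  \<comment> \<open>Both functions are extensional, so they can differ only inside the index set;
    strictness at this one coordinate makes the whole sum strict.\<close>
  moreover obtain p where "p \<in> ?P" "\<theta> p \<noteq> \<eta> p"
    using assms(1-3) PiE_ext[of \<theta> ?P "\<lambda>_. UNIV" \<eta>] unfolding param_cone_def by auto
  ultimately have "(\<Sum>p\<in>?P. ?h ?\<mu> p) < (\<Sum>p\<in>?P. (?h \<theta> p + ?h \<eta> p) / 2)"
    using less by (intro sum_strict_mono_ex1[OF finite_index_pairs]) blast+
  then show ?thesis
    unfolding obj by (simp only: sum_divide_distrib[symmetric] sum.distrib)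
qed

theorem theorem3p2:
  fixes l m :: nat and w :: "nat \<Rightarrow> nat \<Rightarrow> nat"
  assumes "l \<ge> 1" and "m \<ge> 1"
    and "\<And>j. j \<in> {1..l} \<Longrightarrow> (\<Sum>k\<in>{1..m}. w j k) > 0"
    and "\<And>k. k \<in> {1..m} \<Longrightarrow> (\<Sum>j\<in>{1..l}. w j k) > 0"
  shows "\<exists>!\<theta>. \<theta> \<in> param_cone l m w \<and>
           (\<forall>\<eta> \<in> param_cone l m w. objective l m w \<theta> \<le> objective l m w \<eta>)"
proof -
  let ?P = "index_pairs l m w" and ?f = "objective l m w" and ?\<Theta> = "param_cone l m w"
  have n: "total_weight l m w > 0"
    unfolding total_weight_def
    using assms(1,3) by (intro sum_pos[of _ "\<lambda>j. \<Sum>k\<in>{1..m}. w j k"]) auto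
  let ?zero = "\<lambda>p\<in>?P. 0 :: real"
  have zero: "?zero \<in> ?\<Theta>"
    by (rule zero_in_param_cone)
  \<comment> \<open>The level is the value at zero, so the sublevel set is nonempty and a minimizer
    over the box \<open>K\<close> also beats every cone point outside the sublevel set.\<close>
  define C where "C = ?f ?zero"
  have "0 \<le> C"
    unfolding C_def objective_def by (intro sum_nonneg) auto
  define K where "K = ?\<Theta> \<inter> (?P \<rightarrow>\<^sub>E {- 5 * C..5 * C})"
  have sublevel: "\<theta> \<in> K" if "\<theta> \<in> ?\<Theta>" "?f \<theta> \<le> C" for \<theta>
    using objective_sublevel_bounded[OF assms(3,4) that(1) n that(2) \<open>0 \<le> C\<close>] that(1)
    unfolding K_def by (auto simp: param_cone_def PiE_iff)
  have "?zero \<in> K"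
    using sublevel[OF zero] unfolding C_def by simp
  have "compact K"
    unfolding K_def by (rule compact_param_cone_box)
  moreover have "K \<noteq> {}"
    using \<open>?zero \<in> K\<close> by blast
  ultimately obtain \<theta> where \<theta>: "\<theta> \<in> K" "\<And>\<eta>. \<eta> \<in> K \<Longrightarrow> ?f \<theta> \<le> ?f \<eta>"
    using continuous_attains_inf[OF _ _ continuous_on_objective] by metis
  have min: "?f \<theta> \<le> ?f \<eta>" if "\<eta> \<in> ?\<Theta>" for \<eta>
  proof (cases "?f \<eta> \<le> C")
    case True
    then show ?thesis using \<theta>(2) sublevel[OF that] by blast
  next
    case False
    then show ?thesis using \<theta>(2)[OF \<open>?zero \<in> K\<close>] unfolding C_def by simp
  qed
  show ?thesis
  proof (rule ex1I)
    show "\<theta> \<in> ?\<Theta> \<and> (\<forall>\<eta>\<in>?\<Theta>. ?f \<theta> \<le> ?f \<eta>)"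
      using \<theta>(1) min unfolding K_def by blast
  next
    fix \<eta> assume \<eta>: "\<eta> \<in> ?\<Theta> \<and> (\<forall>\<xi>\<in>?\<Theta>. ?f \<eta> \<le> ?f \<xi>)"
    show "\<eta> = \<theta>"
    proof (rule ccontr)
      assume "\<eta> \<noteq> \<theta>"
      \<comment> \<open>The midpoint of two distinct minimizers would have a value strictly below
        their average.\<close>
      let ?\<mu> = "\<lambda>p\<in>?P. (\<eta> p + \<theta> p) / 2"
      have "\<theta> \<in> ?\<Theta>" using \<theta>(1) unfolding K_def by simp
      then have "?\<mu> \<in> ?\<Theta>" "?f ?\<mu> < (?f \<eta> + ?f \<theta>) / 2"
        using midpoint_in_param_cone objective_midpoint_less[OF _ _ \<open>\<eta> \<noteq> \<theta>\<close> n] \<eta> by auto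
      moreover have "?f \<eta> \<le> ?f ?\<mu>" "?f \<theta> \<le> ?f ?\<mu>"
        using \<eta> min \<open>?\<mu> \<in> ?\<Theta>\<close> by blast+
      ultimately show False by simp
    qed
  qed
qed

end
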